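(* Let $P(z)$ be an algebraic polynomial of degree $2$ satisfying $P(1)=1$, whose roots, listed with multiplicity, are $z_1=-1$ and $z_2\in\mathbb{C}$. Then the inequality $$|P(z)|^2+|P(-z)|^2\le 1\quad\text{for a.e. } z\in\mathbb{T}$$ holds if and only if $z_2\le 0$ (that is, $z_2$ is real and $z_2\le 0$).
   Context: Algebraic polynomials have complex coefficients, and $\mathbb{T}=\{z\in\mathbb{C}:|z|=1\}$ is the unit circle. *)

theory Defs
  imports "HOL-Analysis.Analysis" "HOL-Computational_Algebra.Polynomial"
begin

(* Arc length on the unit circle. The total mass is 2 * pi; normalising it would not change
   the null sets. *)
definition circle_measure :: "complex measure" where
  "circle_measure =
     distr (restrict_space lborel {0..<2 * pi}) (restrict_space borel (sphere 0 1)) cis"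

lemma cis_measurable_circle [measurable]:
  "cis \<in> restrict_space lborel {0..<2 * pi} \<rightarrow>\<^sub>M restrict_space borel (sphere 0 1)"
proof (rule measurable_restrict_space2)
  show "cis \<in> space (restrict_space lborel {0..<2 * pi}) \<rightarrow> sphere 0 1"
    by simp
  have "cis \<in> borel_measurable borel"
    by (intro borel_measurable_continuous_onI continuous_intros)
  then show "cis \<in> borel_measurable (restrict_space lborel {0..<2 * pi})"
    by (simp add: measurable_restrict_space1)
qed

lemma space_circle_measure: "space circle_measure = sphere 0 1"
  by (simp add: circle_measure_def space_restrict_space)

lemma emeasure_circle_measure: "emeasure circle_measure (sphere 0 1) = ennreal (2 * pi)"
proof -
  have "sphere 0 1 \<in> sets (restrict_space borel (sphere (0 :: complex) 1))"
    by (metis sets.top space_borel space_restrict_space2 space_restrict_space Int_UNIV_right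
        space_in_borel)
  moreover have "cis -` sphere 0 1 \<inter> space (restrict_space lborel {0..<2 * pi}) = {0..<2 * pi}"
    by (auto simp: space_restrict_space)
  ultimately show ?thesis
    by (simp add: circle_measure_def emeasure_distr emeasure_restrict_space)
qed

lemma AE_circle_measure_iff:
  assumes "{z \<in> sphere 0 1. Q z} \<in> sets (restrict_space borel (sphere 0 1))"
  shows "(AE z in circle_measure. Q z) \<longleftrightarrow> (AE t in lborel. t \<in> {0..<2 * pi} \<longrightarrow> Q (cis t))"
proof -
  have "{z \<in> space (restrict_space borel (sphere 0 1)). Q z}
      \<in> sets (restrict_space borel (sphere 0 1))"
    using assms by (simp add: space_restrict_space)
  then show ?thesis
    unfolding circle_measure_def
    by (simp add: AE_distr_iff[OF cis_measurable_circle] AE_restrict_space_iff)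
qed

end

theory Submission
  imports Defs "HOL-Computational_Algebra.Fundamental_Theorem_Algebra"
begin

text \<open>
  Write \<open>w\<close> for the second root, so that \<open>P z = (z + 1) (z - w) / (2 (1 - w))\<close> with \<open>w \<noteq> 1\<close>.
  On the unit circle \<open>|z \<plusminus> 1|\<^sup>2 = 2 \<plusminus> 2 Re z\<close> and
  \<open>|z \<minusplus> w|\<^sup>2 = 1 + |w|\<^sup>2 \<minusplus> 2 Re (w z')\<close> with \<open>z'\<close> the conjugate of \<open>z\<close>. Adding the two
  products leaves the exact formula
  \<open>|1 - w|\<^sup>2 (1 - |P z|\<^sup>2 - |P (-z)|\<^sup>2) = 2 Im z Im (w z')\<close>
  (lemma \<open>circle_defect_identity\<close>), so the inequality says that \<open>Im z\<close> and \<open>Im (w z')\<close>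
  never have opposite signs.

  Arc length charges every nonempty relatively open part of the circle, so for a continuous function
  an almost everywhere bound is a bound at every point (lemma \<open>AE_circle_le_iff\<close>).
  It remains to decide when \<open>Im z Im (w z') \<ge> 0\<close> on the whole circle. For real \<open>w\<close> the product is
  \<open>- w (Im z)\<^sup>2\<close>. In general, \<open>z = \<i>\<close> forces \<open>Re w \<le> 0\<close>, and \<open>z\<close> in the direction of
  \<open>1 - w\<close> gives a negative multiple of \<open>(Im w)\<^sup>2\<close>, which forces \<open>Im w = 0\<close>.
\<close>

text \<open>
  In the angle \<open>t\<close>, the points where the bound fails form an open null subset of \<open>(0, 2\<pi>)\<close>, which
  must be empty. Continuity then carries the bound to \<open>t = 0\<close>, that is, to the point \<open>1\<close>.
\<close>
lemma AE_circle_le_iff: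
  fixes g :: "complex \<Rightarrow> real"
  assumes cont: "continuous_on UNIV g"
  shows "(AE z in circle_measure. g z \<le> c) \<longleftrightarrow> (\<forall>z\<in>sphere 0 1. g z \<le> c)"
proof
  assume ae: "AE z in circle_measure. g z \<le> c"
  have "closed {z. g z \<le> c}"
    using cont by (intro closed_Collect_le) auto
  then have "{z. g z \<le> c} \<in> sets borel"
    by (rule borel_closed)
  then have "{z \<in> sphere 0 1. g z \<le> c} \<in> sets (restrict_space borel (sphere 0 1))"
    by (auto simp: sets_restrict_space)
  with ae have ae': "AE t in lborel. t \<in> {0..<2 * pi} \<longrightarrow> g (cis t) \<le> c"
    by (simp add: AE_circle_measure_iff)
  have cont_cis: "continuous_on S (\<lambda>t. g (cis t))" for S
    by (rule continuous_on_compose2[OF cont]) (auto intro!: continuous_intros)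
  let ?B = "{0<..<2 * pi} \<inter> {t. c < g (cis t)}"
  have "open ?B"
    by (intro open_Int open_Collect_less cont_cis continuous_intros)
  moreover have "negligible ?B"
  proof -
    have "?B \<in> sets lborel"
      using \<open>open ?B\<close> by simp
    moreover have "AE t in lborel. t \<notin> ?B"
      using ae' by eventually_elim auto
    ultimately have "?B \<in> null_sets lborel"
      by (simp add: AE_iff_null_sets)
    then show ?thesis
      by (simp add: negligible_iff_null_sets null_sets_completionI)
  qed
  ultimately have "?B = {}"
    using open_not_negligible by blast
  then have open_arc: "g (cis t) \<le> c" if "t \<in> {0<..<2 * pi}" for t
    using that by force
  have closed_arc: "g (cis t) \<le> c" if "t \<in> {0..2 * pi}" for t
  proof (rule continuous_le_on_closure[where f = "\<lambda>t. g (cis t)" and S = "{0<..<2 * pi}"])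
    show "continuous_on (closure {0<..<2 * pi}) (\<lambda>t. g (cis t))"
      by (rule cont_cis)
    show "t \<in> closure {0<..<2 * pi}"
      using that by simp
  qed (rule open_arc)
  show "\<forall>z\<in>sphere 0 1. g z \<le> c"
  proof
    fix z :: complex
    assume "z \<in> sphere 0 1"
    then have "norm z = 1"
      by simp
    then have "z = cis (Arg2pi z)"
      using Arg2pi_eq [of z] by (simp add: cis_conv_exp mult.commute)
    moreover have "Arg2pi z \<in> {0..2 * pi}"
      using Arg2pi_ge_0[of z] Arg2pi_lt_2pi[of z] by simp
    ultimately show "g z \<le> c"
      using closed_arc by metis
  qed
next
  assume "\<forall>z\<in>sphere 0 1. g z \<le> c"
  then show "AE z in circle_measure. g z \<le> c"
    by (intro AE_I2) (simp add: space_circle_measure)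
qed

lemma poly_eq_of_proots_pair:
  fixes P :: "complex poly"
  assumes "poly P 1 = 1" and "proots P = {#-1, w#}"
  shows "w \<noteq> 1" and "poly P z = (z + 1) * (z - w) / (2 * (1 - w))"
proof -
  have P: "poly P x = lead_coeff P * ((x + 1) * (x - w))" for x
    using arg_cong[OF complex_poly_decompose_multiset[of P], of "\<lambda>p. poly p x"] assms(2)
    by (simp add: algebra_simps)
  with assms(1) have eq: "lead_coeff P * (2 * (1 - w)) = 1"
    by (metis one_add_one)
  then show "w \<noteq> 1"
    by auto
  with eq have "lead_coeff P = 1 / (2 * (1 - w))"
    by (simp add: field_simps)
  then show "poly P z = (z + 1) * (z - w) / (2 * (1 - w))"
    by (simp add: P)
qed

text \<open>
  On the circle the products \<open>(2 \<plusminus> 2 Re z) (1 + |w|\<^sup>2 \<minusplus> 2 Re (w z'))\<close>, with \<open>z'\<close> the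
  conjugate of \<open>z\<close>, add up to \<open>4 (1 + |w|\<^sup>2) - 8 Re z Re (w z')\<close>. Since \<open>w = (w z') z\<close>, also
  \<open>Re w = Re z Re (w z') - Im z Im (w z')\<close>, which turns this sum into
  \<open>4 |1 - w|\<^sup>2 - 8 Im z Im (w z')\<close>.
\<close>
lemma circle_defect_identity:
  assumes z: "cmod z = 1" and w: "w \<noteq> 1"
  shows "(cmod ((z + 1) * (z - w) / (2 * (1 - w))))\<^sup>2
           + (cmod ((- z + 1) * (- z - w) / (2 * (1 - w))))\<^sup>2
         = 1 - 2 * Im z * Im (w * cnj z) / (cmod (1 - w))\<^sup>2"
proof -
  have unit: "(Re z)\<^sup>2 + (Im z)\<^sup>2 = 1"
    using z by (simp add: cmod_def)
  have pos: "(cmod (1 - w))\<^sup>2 \<noteq> 0"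
    using w by simp
  let ?N = "(cmod (z + 1))\<^sup>2 * (cmod (z - w))\<^sup>2 + (cmod (- z + 1))\<^sup>2 * (cmod (- z - w))\<^sup>2"
  have "?N = 4 * (cmod (1 - w))\<^sup>2 - 8 * Im z * Im (w * cnj z)"
    using unit unfolding cmod_power2 by simp algebra
  moreover have "(cmod ((z + 1) * (z - w) / (2 * (1 - w))))\<^sup>2
      + (cmod ((- z + 1) * (- z - w) / (2 * (1 - w))))\<^sup>2 = ?N / (4 * (cmod (1 - w))\<^sup>2)"
    by (simp only: norm_mult norm_divide norm_numeral power_mult_distrib power_divide
        add_divide_distrib) simp
  ultimately show ?thesis
    using pos by (simp only: diff_divide_distrib) simp
qed

text \<open>
  The unit vector \<open>z\<close> along \<open>1 - w\<close> is the useful test point because \<open>w (1 - w')\<close> and \<open>1 - w\<close>,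
  with \<open>w'\<close> the conjugate of \<open>w\<close>, have the opposite imaginary parts \<open>Im w\<close> and \<open>- Im w\<close>.
\<close>
lemma Im_mult_Im_nonneg_on_circle_iff:
  assumes "w \<noteq> 1"
  shows "(\<forall>z\<in>sphere 0 1. 0 \<le> Im z * Im (w * cnj z)) \<longleftrightarrow> w \<in> \<real> \<and> Re w \<le> 0"
proof
  assume nonneg: "\<forall>z\<in>sphere 0 1. 0 \<le> Im z * Im (w * cnj z)"
  from bspec[OF nonneg, of \<i>] have "Re w \<le> 0"
    by simp
  let ?r = "cmod (1 - w)"
  have r: "?r > 0"
    using assms by simp
  have "0 \<le> Im (sgn (1 - w)) * Im (w * cnj (sgn (1 - w)))"
    using assms by (intro bspec[OF nonneg]) (simp add: norm_sgn)
  also have "\<dots> = - (Im w / ?r)\<^sup>2"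
    using r by (simp add: sgn_eq field_simps power2_eq_square)
  finally have "Im w = 0"
    using r by simp
  with \<open>Re w \<le> 0\<close> show "w \<in> \<real> \<and> Re w \<le> 0"
    by (simp add: complex_is_Real_iff)
next
  assume "w \<in> \<real> \<and> Re w \<le> 0"
  then have "Im z * Im (w * cnj z) = - Re w * (Im z)\<^sup>2" and "Re w \<le> 0" for z
    by (simp_all add: complex_is_Real_iff power2_eq_square)
  then show "\<forall>z\<in>sphere 0 1. 0 \<le> Im z * Im (w * cnj z)"
    by (simp add: mult_nonpos_nonneg)
qed

theorem proposition1:
  fixes P :: "complex poly" and z2 :: complex
  assumes "degree P = 2"
    and "poly P 1 = 1"
    and "proots P = {#-1, z2#}"
  shows "(AE z in circle_measure. (cmod (poly P z))\<^sup>2 + (cmod (poly P (- z)))\<^sup>2 \<le> 1)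
         \<longleftrightarrow> (z2 \<in> \<real> \<and> Re z2 \<le> 0)"
proof -
  note P = poly_eq_of_proots_pair[OF assms(2,3)]
  have pos: "(cmod (1 - z2))\<^sup>2 > 0"
    using P(1) by simp
  have pointwise: "(cmod (poly P z))\<^sup>2 + (cmod (poly P (- z)))\<^sup>2 \<le> 1
      \<longleftrightarrow> 0 \<le> Im z * Im (z2 * cnj z)" if "z \<in> sphere 0 1" for z
  proof -
    have "cmod z = 1"
      using that by simp
    then have "(cmod (poly P z))\<^sup>2 + (cmod (poly P (- z)))\<^sup>2
        = 1 - 2 * (Im z * Im (z2 * cnj z)) / (cmod (1 - z2))\<^sup>2"
      unfolding P(2) by (simp only: circle_defect_identity[OF _ P(1)] mult.assoc)
    then show ?thesis
      using pos by (simp add: zero_le_divide_iff del: times_complex.sel)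
  qed
  have "continuous_on UNIV (\<lambda>z. (cmod (poly P z))\<^sup>2 + (cmod (poly P (- z)))\<^sup>2)"
    by (intro continuous_intros)
  then have "(AE z in circle_measure. (cmod (poly P z))\<^sup>2 + (cmod (poly P (- z)))\<^sup>2 \<le> 1)
      \<longleftrightarrow> (\<forall>z\<in>sphere 0 1. (cmod (poly P z))\<^sup>2 + (cmod (poly P (- z)))\<^sup>2 \<le> 1)"
    by (rule AE_circle_le_iff)
  also have "\<dots> \<longleftrightarrow> (\<forall>z\<in>sphere 0 1. 0 \<le> Im z * Im (z2 * cnj z))"
    using pointwise by (intro ball_cong refl)
  also have "\<dots> \<longleftrightarrow> z2 \<in> \<real> \<and> Re z2 \<le> 0"
    by (rule Im_mult_Im_nonneg_on_circle_iff[OF P(1)])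
  finally show ?thesis .
qed

end
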